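(* There is an absolute constant $c>0$ such that for all $1<p<\infty$ and all integers $n\ge2$, $$c\,n^{\alpha_p}\le\sup_{f\ne0}\frac{\|f(S_{n,p})\|}{\|f\|_{W(S_{n,p})}}\le e\,n^{\alpha_p}$$ and $$c\,n^{\alpha_p}\le\sup_{f\ne0}\frac{\|f(S_{n,p})\|}{\|f\|_{V_{n,p}(S_{n,p})}}\le e\,n^{\alpha_p},$$ where the suprema are over all nonzero polynomials $f$, and $V_{n,p}(T):=V(T,\mathcal L(\ell_p^n))$ for $T\in\mathcal L(\ell_p^n)$.
   Context: $\ell_p^n$ is $\mathbb C^n$ with the $\|\cdot\|_p$-norm and standard basis $e_0,\dots,e_{n-1}$; $\mathcal L(\ell_p^n)$ carries the operator norm. Polynomials are in one variable with complex coefficients, and $e$ in the bounds is Euler's number. Put $\alpha_p:=\left|\frac1p-\frac12\right|$. The truncated unilateral shift $S_{n,p}\in\mathcal L(\ell_p^n)$ is given by $S_{n,p}e_j=e_{j+1}$ for $0\le j\le n-2$ and $S_{n,p}e_{n-1}=0$. For a compact set $E\subset\mathbb C$ and a polynomial $f$, $\|f\|_E:=\sup_{z\in E}|f(z)|$. With $1/p+1/q=1$, the dual of $\ell_p^n$ is identified with $\ell_q^n$ via $\langle x,y\rangle=\sum_j x_j\overline{y_j}$, and $J(x)=(x_j|x_j|^{p-2})_j$ (with $0$ in the coordinates where $x_j=0$). The numerical range is $W(T)=\{\langle Tx,J(x)\rangle:\ x\in\ell_p^n,\ \|x\|_p=1\}$. For a unital Banach algebra $\mathcal A$ with unit $1_{\mathcal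 A}$ and $a\in\mathcal A$, the algebraic numerical range is $V(a,\mathcal A)=\{\varphi(a):\varphi\in\mathcal A^*,\ \|\varphi\|=1=\varphi(1_{\mathcal A})\}$. *)

theory Defs
  imports
    "HOL-Library.Extended_Real"
    "HOL-Computational_Algebra.Polynomial"
    "Jordan_Normal_Form.Matrix"
    "Jordan_Normal_Form.Conjugate"
begin

text \<open>The space \<open>\<ell>\<^sub>p\<^sup>n\<close> is \<open>carrier_vec n\<close> over the complex numbers, with coordinates indexed
  \<open>0, \<dots>, n - 1\<close> and standard basis \<open>unit_vec n j\<close>, normed by \<open>lp_norm p\<close>. The algebra of operators
  on it is \<open>carrier_mat n n\<close>, with \<open>A\<close> acting by \<open>x \<mapsto> A *\<^sub>v x\<close>.\<close>

definition lp_norm :: "real \<Rightarrow> complex vec \<Rightarrow> real" where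
  "lp_norm p x = (\<Sum>j<dim_vec x. cmod (x $ j) powr p) powr (1 / p)"

definition op_norm :: "real \<Rightarrow> nat \<Rightarrow> complex mat \<Rightarrow> real" where
  "op_norm p n A = (SUP x\<in>{x \<in> carrier_vec n. lp_norm p x \<le> 1}. lp_norm p (A *\<^sub>v x))"

definition trunc_shift :: "nat \<Rightarrow> complex mat" where
  "trunc_shift n = mat n n (\<lambda>(i, j). if i = j + 1 then 1 else 0)"

lemma trunc_shift_unit_vec:
  assumes "j < n"
  shows "trunc_shift n *\<^sub>v unit_vec n j = (if j + 1 < n then unit_vec n (j + 1) else 0\<^sub>v n)"
  using assms by (intro eq_vecI) (auto simp: trunc_shift_def mult_mat_vec_def)

text \<open>The matrix \<open>f(A) = \<Sum>\<^sub>k coeff f k \<cdot> A\<^sup>k\<close>, written entrywise because the type of matrices of all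
  sizes is not a type-class ring.\<close>

definition poly_at_mat :: "nat \<Rightarrow> complex poly \<Rightarrow> complex mat \<Rightarrow> complex mat" where
  "poly_at_mat n f A = mat n n (\<lambda>(i, j). \<Sum>k\<le>degree f. coeff f k * (A ^\<^sub>m k) $$ (i, j))"

text \<open>Suprema of \<open>|f|\<close> are taken in the extended reals, so that no boundedness is presupposed.\<close>

definition sup_norm_on :: "complex set \<Rightarrow> complex poly \<Rightarrow> ereal" where
  "sup_norm_on E f = (SUP z\<in>E. ereal (cmod (poly f z)))"

text \<open>Since \<open>0 powr a = 0\<close> for every \<open>a\<close>, vanishing coordinates are mapped to \<open>0\<close>, also for \<open>p < 2\<close>.\<close>

definition duality_map :: "real \<Rightarrow> complex vec \<Rightarrow> complex vec" where
  "duality_map p x = vec (dim_vec x) (\<lambda>j. x $ j * complex_of_real (cmod (x $ j) powr (p - 2)))"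

text \<open>The pairing \<open>x \<bullet>c y\<close> is \<open>\<Sum>\<^sub>j x\<^sub>j * cnj y\<^sub>j\<close>, conjugate linear in the second argument.\<close>

definition num_range :: "real \<Rightarrow> nat \<Rightarrow> complex mat \<Rightarrow> complex set" where
  "num_range p n T =
     {(T *\<^sub>v x) \<bullet>c duality_map p x | x. x \<in> carrier_vec n \<and> lp_norm p x = 1}"

text \<open>The dual Banach space of the operator algebra. Functionals are total functions on the type of
  matrices of all sizes; only their values on \<open>carrier_mat n n\<close> matter.\<close>

definition op_dual :: "real \<Rightarrow> nat \<Rightarrow> (complex mat \<Rightarrow> complex) set" where
  "op_dual p n = {\<phi>.
     (\<forall>A\<in>carrier_mat n n. \<forall>B\<in>carrier_mat n n. \<phi> (A + B) = \<phi> A + \<phi> B) \<and>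
     (\<forall>c. \<forall>A\<in>carrier_mat n n. \<phi> (c \<cdot>\<^sub>m A) = c * \<phi> A) \<and>
     (\<exists>K. \<forall>A\<in>carrier_mat n n. cmod (\<phi> A) \<le> K * op_norm p n A)}"

definition dual_norm :: "real \<Rightarrow> nat \<Rightarrow> (complex mat \<Rightarrow> complex) \<Rightarrow> real" where
  "dual_norm p n \<phi> = (SUP A\<in>{A \<in> carrier_mat n n. op_norm p n A \<le> 1}. cmod (\<phi> A))"

definition alg_num_range :: "real \<Rightarrow> nat \<Rightarrow> complex mat \<Rightarrow> complex set" where
  "alg_num_range p n T = {\<phi> T | \<phi>. \<phi> \<in> op_dual p n \<and> dual_norm p n \<phi> = 1 \<and> \<phi> (1\<^sub>m n) = 1}"

definition alpha_exp :: "real \<Rightarrow> real" where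
  "alpha_exp p = \<bar>1 / p - 1 / 2\<bar>"

end

theory Submission
  imports Defs "HOL-Analysis.Convex"
begin

text \<open>Write \<open>S\<close> for the truncated shift, \<open>W\<close> for its numerical range and \<open>V\<close> for its algebraic
  numerical range. Both are controlled through the inclusions
  \<open>C \<subseteq> W \<subseteq> V \<subseteq> D\<close>, where \<open>C\<close> is the circle of radius \<open>1 - 1 / n\<close> and \<open>D\<close> the closed unit disc.
  The first holds because constant-modulus unit vectors already attain every point of \<open>C\<close>, the
  second because \<open>A \<mapsto> \<langle>Ax, J(x)\<rangle>\<close> is a norm-one functional by Hoelder's inequality, the third
  because \<open>S\<close> is a contraction. It remains to bound \<open>\<parallel>f(S)\<parallel>\<close> from above by values of \<open>f\<close> on \<open>C\<close>,
  and to find one \<open>f\<close> of small modulus on \<open>D\<close> with large \<open>\<parallel>f(S)\<parallel>\<close>.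

  For the upper bound, \<open>f(S)x\<close> consists of the first \<open>n\<close> coefficients of a product of polynomials,
  \<open>f\<close> times the polynomial with coefficients \<open>x\<close>. Parseval's identity on \<open>C\<close>, in its discrete form
  over scaled roots of unity, gives von Neumann's inequality for \<open>f(S)\<close> in the 2-norm with weights
  \<open>(1 - 1 / n) ^ j\<close> (\<open>weighted_l2_coeff_mult_le\<close>). Removing the weights costs at most
  \<open>(1 - 1 / n) powr (1 - n) \<le> e\<close>, and passing from the 2-norm to the \<open>p\<close>-norm costs
  \<open>n powr \<alpha>\<^sub>p\<close> (\<open>lp_norm_bound_from_l2_bound\<close>).

  For the lower bound, let \<open>N\<close> be the largest power of two up to \<open>n\<close> and \<open>f\<close> the Rudin--Shapiro
  polynomial with \<open>N\<close> coefficients. They all have modulus one, yet \<open>\<bar>f\<bar> \<le> sqrt (2 * N)\<close> on \<open>D\<close>. A column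
  and a row of the Toeplitz matrix \<open>f(S)\<close> show that its norm is at least \<open>N powr (1 / p)\<close> and at
  least \<open>N powr (1 - 1 / p)\<close>, hence at least \<open>N powr (1 / 2 + \<alpha>\<^sub>p)\<close>
  (\<open>op_norm_poly_at_trunc_shift_ge\<close>). As \<open>N > n / 2\<close> and \<open>\<alpha>\<^sub>p \<le> 1 / 2\<close>, the quotient is at least
  \<open>n powr \<alpha>\<^sub>p / 2\<close>.\<close>

section \<open>Comparison of the lp norms\<close>

lemma lp_norm_nonneg: "0 \<le> lp_norm p x"
  by (simp add: lp_norm_def)

lemma lp_norm_powr:
  assumes "p > 0"
  shows "lp_norm p x powr p = (\<Sum>j<dim_vec x. cmod (x $ j) powr p)"
  using assms by (simp add: lp_norm_def powr_powr sum_nonneg)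

lemma lp_norm_le_iff:
  assumes "p > 0" "0 \<le> B"
  shows "lp_norm p x \<le> B \<longleftrightarrow> (\<Sum>j<dim_vec x. cmod (x $ j) powr p) \<le> B powr p"
proof -
  have "lp_norm p x \<le> B \<longleftrightarrow> lp_norm p x powr p \<le> B powr p"
    using assms lp_norm_nonneg[of p x] by (metis powr_less_mono2 powr_mono2 not_le less_imp_le)
  then show ?thesis using lp_norm_powr[OF assms(1)] by simp
qed

lemma norm_entry_le_lp_norm:
  assumes "p > 0" "j < dim_vec x"
  shows "cmod (x $ j) \<le> lp_norm p x"
proof -
  have "cmod (x $ j) powr p \<le> (\<Sum>j<dim_vec x. cmod (x $ j) powr p)"
    using assms by (intro member_le_sum) auto
  also have "\<dots> = lp_norm p x powr p"
    using lp_norm_powr[OF assms(1)] by simp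
  finally show ?thesis
    using assms lp_norm_nonneg[of p x] by (meson powr_less_mono2 not_le)
qed

text \<open>Since no entry exceeds \<open>B = lp_norm r x\<close>, each \<open>s\<close>-th power of an entry is at most
  \<open>B powr (s - r)\<close> times its \<open>r\<close>-th power.\<close>

lemma lp_norm_antimono:
  assumes "0 < r" "r \<le> s"
  shows "lp_norm s x \<le> lp_norm r x"
proof -
  define B where "B = lp_norm r x"
  have B: "0 \<le> B" by (simp add: B_def lp_norm_nonneg)
  have "(\<Sum>j<dim_vec x. cmod (x $ j) powr s)
      \<le> (\<Sum>j<dim_vec x. cmod (x $ j) powr r * B powr (s - r))"
  proof (intro sum_mono)
    fix j assume "j \<in> {..<dim_vec x}"
    then have "cmod (x $ j) powr (s - r) \<le> B powr (s - r)"
      using assms norm_entry_le_lp_norm[of r j x] by (intro powr_mono2) (auto simp: B_def)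
    then have "cmod (x $ j) powr r * cmod (x $ j) powr (s - r)
        \<le> cmod (x $ j) powr r * B powr (s - r)"
      by (intro mult_left_mono) auto
    then show "cmod (x $ j) powr s \<le> cmod (x $ j) powr r * B powr (s - r)"
      by (simp flip: powr_add)
  qed
  also have "\<dots> = B powr r * B powr (s - r)"
    using lp_norm_powr[OF assms(1), of x] by (simp add: B_def sum_distrib_right)
  also have "\<dots> = B powr s" by (simp flip: powr_add)
  finally show ?thesis
    using assms B by (subst lp_norm_le_iff) (auto simp: B_def)
qed

text \<open>This is Jensen's inequality for the concave function \<open>u \<mapsto> u powr (r / s)\<close> on the uniform
  distribution over the coordinates, proved by summing the tangent-line inequality at the mean.\<close>

lemma lp_norm_le_card_powr:
  assumes "0 < r" "r \<le> s" "0 < dim_vec x"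
  shows "lp_norm r x \<le> real (dim_vec x) powr (1 / r - 1 / s) * lp_norm s x"
proof -
  define N where "N = real (dim_vec x)"
  define B where "B = lp_norm s x"
  define \<theta> where "\<theta> = r / s"
  have N: "N > 0" using assms by (simp add: N_def)
  have \<theta>: "0 < \<theta>" "\<theta> \<le> 1" using assms by (auto simp: \<theta>_def)
  have s: "s > 0" using assms by simp
  show ?thesis
  proof (cases "B = 0")
    case True
    then have "x $ j = 0" if "j < dim_vec x" for j
      using norm_entry_le_lp_norm[OF s that] by (simp add: B_def)
    then show ?thesis by (simp add: lp_norm_def)
  next
    case False
    then have B: "B > 0" using lp_norm_nonneg[of s x] by (simp add: B_def)
    have tangent: "u powr \<theta> \<le> \<theta> * u + (1 - \<theta>)" if "0 \<le> u" for u :: real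
    proof (cases "u = 0")
      case False
      then show ?thesis
        using Youngs_inequality_0[of \<theta> "1 - \<theta>" u 1] \<theta> that by simp
    qed (use \<theta> in simp)
    \<comment> \<open>The mean of the \<open>cmod (x $ j) powr s\<close> is \<open>B powr s / N\<close>. Dividing by it normalises the
        mean to one, so the sum of the right-hand sides is \<open>N\<close>.\<close>
    have "(\<Sum>j<dim_vec x. (N * cmod (x $ j) powr s / B powr s) powr \<theta>)
        \<le> (\<Sum>j<dim_vec x. \<theta> * (N * cmod (x $ j) powr s / B powr s) + (1 - \<theta>))"
      using N by (intro sum_mono tangent) auto
    also have "\<dots> = \<theta> * N * (\<Sum>j<dim_vec x. cmod (x $ j) powr s) / B powr s + N * (1 - \<theta>)"
      by (simp add: sum.distrib sum_distrib_left sum_divide_distrib N_def mult.assoc)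
    also have "\<dots> = \<theta> * N * B powr s / B powr s + N * (1 - \<theta>)"
      using lp_norm_powr[OF s, of x] by (simp add: B_def)
    also have "\<dots> = N"
      using B by (simp add: algebra_simps)
    also have "(\<Sum>j<dim_vec x. (N * cmod (x $ j) powr s / B powr s) powr \<theta>)
        = (\<Sum>j<dim_vec x. cmod (x $ j) powr r) * (N powr \<theta> / B powr r)"
      unfolding sum_distrib_right using N B s
      by (intro sum.cong) (simp_all add: powr_divide powr_mult powr_powr \<theta>_def)
    finally have "(\<Sum>j<dim_vec x. cmod (x $ j) powr r) \<le> N / (N powr \<theta> / B powr r)"
      using N B by (subst pos_le_divide_eq) simp_all
    also have "\<dots> = N powr (1 - \<theta>) * B powr r"
      using N by (simp add: powr_diff)
    also have "1 - \<theta> = (1 / r - 1 / s) * r"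
      using assms by (simp add: \<theta>_def field_simps)
    also have "N powr ((1 / r - 1 / s) * r) * B powr r = (N powr (1 / r - 1 / s) * B) powr r"
      using N B by (simp add: powr_mult powr_powr)
    finally show ?thesis
      using assms N B by (subst lp_norm_le_iff) (auto simp: B_def N_def)
  qed
qed

text \<open>Only one of the two passages between the \<open>p\<close>-norm and the 2-norm costs a power of \<open>n\<close>:
  the one for \<open>y\<close> if \<open>p < 2\<close>, the one for \<open>x\<close> if \<open>p > 2\<close>. This is why the exponent is
  \<open>\<alpha>\<^sub>p\<close> and not \<open>2\<alpha>\<^sub>p\<close>.\<close>

lemma lp_norm_bound_from_l2_bound:
  assumes "p > 0" "n > 0" "dim_vec x = n" "dim_vec y = n" "0 \<le> C"
    and l2: "lp_norm 2 y \<le> C * lp_norm 2 x"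
  shows "lp_norm p y \<le> C * real n powr alpha_exp p * lp_norm p x"
proof (cases "p \<le> 2")
  case True
  then have \<alpha>: "alpha_exp p = 1 / p - 1 / 2"
    using assms by (simp add: alpha_exp_def field_simps)
  have "lp_norm p y \<le> real n powr alpha_exp p * lp_norm 2 y"
    using lp_norm_le_card_powr[of p 2 y] assms True by (simp add: \<alpha>)
  also have "\<dots> \<le> real n powr alpha_exp p * (C * lp_norm p x)"
    using l2 assms True lp_norm_antimono[of p 2 x]
    by (intro mult_left_mono) (auto intro: order_trans mult_left_mono)
  finally show ?thesis by (simp add: mult_ac)
next
  case False
  then have \<alpha>: "alpha_exp p = 1 / 2 - 1 / p"
    using assms by (simp add: alpha_exp_def field_simps)
  have "lp_norm p y \<le> C * lp_norm 2 x"
    using lp_norm_antimono[of 2 p y] l2 False by simp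
  also have "\<dots> \<le> C * (real n powr alpha_exp p * lp_norm p x)"
    using lp_norm_le_card_powr[of 2 p x] assms False by (intro mult_left_mono) (auto simp: \<alpha>)
  finally show ?thesis by (simp add: mult_ac)
qed

section \<open>The operator norm\<close>

lemma mult_mat_vec_entry:
  assumes "A \<in> carrier_mat n n" "x \<in> carrier_vec n" "i < n"
  shows "(A *\<^sub>v x) $ i = (\<Sum>j<n. A $$ (i, j) * x $ j)"
  using assms by (auto simp: scalar_prod_def lessThan_atLeast0 intro!: sum.cong)

lemma bdd_above_op_norm:
  assumes "p > 0" "A \<in> carrier_mat n n"
  shows "bdd_above ((\<lambda>x. lp_norm p (A *\<^sub>v x)) ` {x \<in> carrier_vec n. lp_norm p x \<le> 1})"
proof (rule bdd_aboveI2)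
  fix x assume x: "x \<in> {x \<in> carrier_vec n. lp_norm p x \<le> 1}"
  have "cmod ((A *\<^sub>v x) $ i) \<le> (\<Sum>j<n. cmod (A $$ (i, j)))" if i: "i < n" for i
  proof -
    have "(A *\<^sub>v x) $ i = (\<Sum>j<n. A $$ (i, j) * x $ j)"
      using assms x i by (intro mult_mat_vec_entry) auto
    also have "cmod \<dots> \<le> (\<Sum>j<n. cmod (A $$ (i, j)) * 1)"
    proof (intro sum_norm_le)
      fix j assume "j \<in> {..<n}"
      then have "cmod (x $ j) \<le> 1"
        using x norm_entry_le_lp_norm[OF assms(1), of j x] by auto
      then show "cmod (A $$ (i, j) * x $ j) \<le> cmod (A $$ (i, j)) * 1"
        unfolding norm_mult by (intro mult_left_mono) auto
    qed
    finally show ?thesis by simp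
  qed
  then show "lp_norm p (A *\<^sub>v x) \<le> (\<Sum>i<n. (\<Sum>j<n. cmod (A $$ (i, j))) powr p) powr (1 / p)"
    using assms by (auto simp: lp_norm_def intro!: powr_mono2 sum_mono sum_nonneg)
qed

lemma lp_norm_le_op_norm:
  assumes "p > 0" "A \<in> carrier_mat n n" "x \<in> carrier_vec n" "lp_norm p x \<le> 1"
  shows "lp_norm p (A *\<^sub>v x) \<le> op_norm p n A"
  unfolding op_norm_def using assms by (intro cSUP_upper bdd_above_op_norm) auto

lemma op_norm_leI:
  assumes "\<And>x. x \<in> carrier_vec n \<Longrightarrow> lp_norm p x \<le> 1 \<Longrightarrow> lp_norm p (A *\<^sub>v x) \<le> B"
  shows "op_norm p n A \<le> B"
proof -
  have "lp_norm p (0\<^sub>v n) \<le> 1" by (simp add: lp_norm_def)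
  then have "0\<^sub>v n \<in> {x \<in> carrier_vec n. lp_norm p x \<le> 1}" by simp
  then show ?thesis
    unfolding op_norm_def using assms by (intro cSUP_least) blast+
qed

lemma op_norm_nonneg:
  assumes "p > 0" "A \<in> carrier_mat n n"
  shows "0 \<le> op_norm p n A"
proof -
  have "lp_norm p (0\<^sub>v n) \<le> 1" by (simp add: lp_norm_def)
  then show ?thesis
    using lp_norm_le_op_norm[OF assms, of "0\<^sub>v n"] lp_norm_nonneg[of p "A *\<^sub>v 0\<^sub>v n"] by simp
qed

section \<open>Polynomials of the truncated shift\<close>

lemma trunc_shift_carrier: "trunc_shift n \<in> carrier_mat n n"
  by (simp add: trunc_shift_def)

lemma poly_at_mat_carrier: "poly_at_mat n f A \<in> carrier_mat n n"
  by (simp add: poly_at_mat_def)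

lemma trunc_shift_mult_vec:
  assumes "x \<in> carrier_vec n" "i < n"
  shows "(trunc_shift n *\<^sub>v x) $ i = (if i = 0 then 0 else x $ (i - 1))"
proof -
  have "(trunc_shift n *\<^sub>v x) $ i = (\<Sum>j<n. (if i = j + 1 then 1 else 0) * x $ j)"
    using assms by (simp add: mult_mat_vec_entry[OF trunc_shift_carrier]) (simp add: trunc_shift_def)
  also have "\<dots> = (\<Sum>j<n. if j = i - 1 then (if i = 0 then 0 else x $ j) else 0)"
    by (intro sum.cong) auto
  also have "\<dots> = (if i = 0 then 0 else x $ (i - 1))"
    using assms by (simp add: less_imp_diff_less)
  finally show ?thesis .
qed

lemma trunc_shift_pow_entry:
  assumes "i < n" "j < n"
  shows "(trunc_shift n ^\<^sub>m m) $$ (i, j) = (if i = j + m then 1 else 0)"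
  using assms
proof (induction m arbitrary: j)
  case 0
  then show ?case by (simp add: trunc_shift_def)
next
  case (Suc m)
  have "(trunc_shift n ^\<^sub>m Suc m) $$ (i, j)
      = (\<Sum>k<n. (trunc_shift n ^\<^sub>m m) $$ (i, k) * trunc_shift n $$ (k, j))"
    using Suc.prems pow_carrier_mat[OF trunc_shift_carrier, of n m] trunc_shift_carrier[of n]
    by (auto simp: scalar_prod_def lessThan_atLeast0 intro!: sum.cong)
  also have "\<dots> = (\<Sum>k<n. if k = j + 1 then (if i = k + m then 1 else 0) else 0)"
    using Suc by (intro sum.cong) (auto simp: trunc_shift_def)
  also have "\<dots> = (if i = j + Suc m then 1 else 0)"
    using Suc.prems by auto
  finally show ?case .
qed

text \<open>This is the lower triangular Toeplitz matrix of the coefficients of \<open>f\<close>.\<close>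

lemma poly_at_trunc_shift_entry:
  assumes "i < n" "j < n"
  shows "poly_at_mat n f (trunc_shift n) $$ (i, j) = (if j \<le> i then coeff f (i - j) else 0)"
proof -
  have "poly_at_mat n f (trunc_shift n) $$ (i, j)
      = (\<Sum>k\<le>degree f. if k = i - j then (if j \<le> i then coeff f k else 0) else 0)"
    using assms unfolding poly_at_mat_def
    by (simp add: trunc_shift_pow_entry del: sum.delta) (intro sum.cong, auto)
  also have "\<dots> = (if j \<le> i then coeff f (i - j) else 0)"
    by (simp add: coeff_eq_0)
  finally show ?thesis .
qed

lemma poly_at_trunc_shift_mult_vec:
  assumes "x \<in> carrier_vec n" "i < n"
  shows "(poly_at_mat n f (trunc_shift n) *\<^sub>v x) $ i = (\<Sum>j\<le>i. coeff f (i - j) * x $ j)"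
proof -
  have "(poly_at_mat n f (trunc_shift n) *\<^sub>v x) $ i
      = (\<Sum>j<n. poly_at_mat n f (trunc_shift n) $$ (i, j) * x $ j)"
    using assms by (intro mult_mat_vec_entry poly_at_mat_carrier)
  also have "\<dots> = (\<Sum>j<n. if j \<le> i then coeff f (i - j) * x $ j else 0)"
    using assms by (intro sum.cong) (auto simp: poly_at_trunc_shift_entry)
  also have "\<dots> = (\<Sum>j\<le>i. coeff f (i - j) * x $ j)"
    using assms by (intro sum.mono_neutral_cong_right) auto
  finally show ?thesis .
qed

definition vec_poly :: "complex vec \<Rightarrow> complex poly" where
  "vec_poly x = (\<Sum>j<dim_vec x. monom (x $ j) j)"

lemma coeff_vec_poly: "coeff (vec_poly x) j = (if j < dim_vec x then x $ j else 0)"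
  by (simp add: vec_poly_def coeff_sum)

text \<open>Acting with \<open>f(S)\<close> is multiplication by \<open>f\<close> followed by truncation at degree \<open>n\<close>.\<close>

lemma poly_at_trunc_shift_eq_coeff_mult:
  assumes "x \<in> carrier_vec n" "i < n"
  shows "(poly_at_mat n f (trunc_shift n) *\<^sub>v x) $ i = coeff (vec_poly x * f) i"
  unfolding coeff_mult poly_at_trunc_shift_mult_vec[OF assms]
  using assms by (intro sum.cong) (auto simp: coeff_vec_poly)

section \<open>Parseval's identity on a circle\<close>

lemma unity_root_orthogonality:
  fixes N :: nat
  defines "\<omega> \<equiv> (\<lambda>k::nat. cis (2 * pi * real k / real N))"
  assumes "i < N" "j < N"
  shows "(\<Sum>k<N. \<omega> k ^ i * cnj (\<omega> k ^ j)) = (if i = j then of_nat N else 0)"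
proof -
  \<comment> \<open>Exchanging the roles of the index and the exponent turns the sum into a geometric series
      with ratio \<open>w\<close>, an \<open>N\<close>-th root of unity.\<close>
  define w where "w = \<omega> i * cnj (\<omega> j)"
  have "\<omega> k ^ i = \<omega> i ^ k" for k i
    by (simp add: \<omega>_def DeMoivre mult_ac)
  then have term_eq: "\<omega> k ^ i * cnj (\<omega> k ^ j) = w ^ k" for k
    by (simp add: w_def power_mult_distrib flip: complex_cnj_power)
  have unit: "\<omega> k * cnj (\<omega> k) = 1" for k
    by (simp add: \<omega>_def cis_cnj cis_mult)
  have root: "\<omega> k ^ N = 1" for k
    using assms by (simp add: \<omega>_def DeMoivre cis_multiple_2pi)
  show ?thesis
  proof (cases "i = j")
    case True
    then show ?thesis unfolding term_eq by (simp add: w_def unit)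
  next
    case False
    have "\<omega> i \<noteq> \<omega> j"
      using bij_betw_roots_unity[of N] assms False
      by (auto simp: bij_betw_def inj_on_def \<omega>_def)
    moreover have "\<omega> i = w * \<omega> j"
      using unit[of j] by (simp add: w_def mult_ac)
    ultimately have "w \<noteq> 1" by auto
    moreover have "w ^ N = 1"
      using root[of i] root[of j] by (simp add: w_def power_mult_distrib flip: complex_cnj_power)
    ultimately show ?thesis
      unfolding term_eq using False by (simp add: geometric_sum)
  qed
qed

lemma parseval_on_circle:
  fixes g :: "complex poly" and N :: nat
  assumes "degree g < N"
  shows "(\<Sum>k<N. (cmod (poly g (of_real r * cis (2 * pi * real k / real N))))\<^sup>2)
       = real N * (\<Sum>j<N. (cmod (coeff g j) * r ^ j)\<^sup>2)"
proof -
  define \<omega> where "\<omega> k = cis (2 * pi * real k / real N)" for k :: nat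
  define b where "b j = coeff g j * of_real r ^ j" for j
  have poly_eq: "poly g (of_real r * \<omega> k) = (\<Sum>i<N. b i * \<omega> k ^ i)" for k
  proof -
    have "poly g (of_real r * \<omega> k) = (\<Sum>i\<le>degree g. b i * \<omega> k ^ i)"
      by (simp add: poly_altdef b_def power_mult_distrib mult.assoc)
    also have "\<dots> = (\<Sum>i<N. b i * \<omega> k ^ i)"
      using assms by (intro sum.mono_neutral_left) (auto simp: b_def coeff_eq_0)
    finally show ?thesis .
  qed
  have "complex_of_real (\<Sum>k<N. (cmod (poly g (of_real r * \<omega> k)))\<^sup>2)
      = (\<Sum>k<N. \<Sum>i<N. \<Sum>j<N. b i * cnj (b j) * (\<omega> k ^ i * cnj (\<omega> k ^ j)))"
    by (simp add: poly_eq complex_norm_square sum_product mult_ac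
        del: complex_cnj_power of_real_power)
  also have "\<dots> = (\<Sum>i<N. \<Sum>k<N. \<Sum>j<N. b i * cnj (b j) * (\<omega> k ^ i * cnj (\<omega> k ^ j)))"
    by (rule sum.swap)
  also have "\<dots> = (\<Sum>i<N. \<Sum>j<N. \<Sum>k<N. b i * cnj (b j) * (\<omega> k ^ i * cnj (\<omega> k ^ j)))"
    by (intro sum.cong refl sum.swap)
  also have "\<dots> = (\<Sum>i<N. \<Sum>j<N. if j = i then of_nat N * (b i * cnj (b j)) else 0)"
    using unity_root_orthogonality[of _ N]
    by (intro sum.cong refl) (auto simp: \<omega>_def simp flip: sum_distrib_left)
  also have "\<dots> = (\<Sum>i<N. of_nat N * (b i * cnj (b i)))"
    by simp
  also have "\<dots> = complex_of_real (real N * (\<Sum>j<N. (cmod (coeff g j) * r ^ j)\<^sup>2))"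
    unfolding of_real_mult of_real_sum sum_distrib_left b_def
    by (intro sum.cong refl)
      (simp add: power_mult_distrib complex_norm_square power2_eq_square[of "_ ^ _"] mult_ac
        flip: of_real_power)
  finally show ?thesis
    unfolding \<omega>_def of_real_eq_iff .
qed

text \<open>The weighted 2-norm of the coefficients of \<open>g * f\<close> is a mean square over points of the circle
  of radius \<open>r\<close>, where \<open>f\<close> is a factor of modulus at most \<open>M\<close>. Dropping the coefficients from
  degree \<open>n\<close> on only decreases the left-hand side, so this is von Neumann's inequality for the
  truncated shift with weights \<open>r ^ j\<close>.\<close>

lemma weighted_l2_coeff_mult_le:
  fixes f g :: "complex poly"
  assumes "degree g < m"
    and M: "\<And>z. cmod z = \<bar>r\<bar> \<Longrightarrow> cmod (poly f z) \<le> M"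
  shows "(\<Sum>i<n. (cmod (coeff (g * f) i) * r ^ i)\<^sup>2) \<le> M\<^sup>2 * (\<Sum>j<m. (cmod (coeff g j) * r ^ j)\<^sup>2)"
proof -
  \<comment> \<open>The number of points only has to be large enough for the discrete Parseval identity to apply
      to both \<open>g * f\<close> and \<open>g\<close>, and for the sums to \<open>n\<close> and \<open>m\<close> to be partial sums.\<close>
  define N where "N = Suc (degree (g * f)) + n + m"
  define z where "z k = of_real r * cis (2 * pi * real k / real N)" for k :: nat
  have N: "degree (g * f) < N" "degree g < N"
    using assms(1) by (auto simp: N_def)
  have "real N * (\<Sum>i<n. (cmod (coeff (g * f) i) * r ^ i)\<^sup>2)
      \<le> real N * (\<Sum>i<N. (cmod (coeff (g * f) i) * r ^ i)\<^sup>2)"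
    by (intro mult_left_mono sum_mono2) (auto simp: N_def)
  also have "\<dots> = (\<Sum>k<N. (cmod (poly (g * f) (z k)))\<^sup>2)"
    using parseval_on_circle[OF N(1), of r] by (simp add: z_def)
  also have "\<dots> \<le> (\<Sum>k<N. M\<^sup>2 * (cmod (poly g (z k)))\<^sup>2)"
  proof (intro sum_mono)
    fix k
    have "cmod (poly f (z k)) \<le> M"
      by (intro M) (simp add: z_def norm_mult)
    then have "(cmod (poly f (z k)))\<^sup>2 \<le> M\<^sup>2"
      by (intro power_mono) auto
    then have "(cmod (poly f (z k)))\<^sup>2 * (cmod (poly g (z k)))\<^sup>2 \<le> M\<^sup>2 * (cmod (poly g (z k)))\<^sup>2"
      by (intro mult_right_mono) auto
    then show "(cmod (poly (g * f) (z k)))\<^sup>2 \<le> M\<^sup>2 * (cmod (poly g (z k)))\<^sup>2"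
      by (simp add: norm_mult power_mult_distrib mult.commute)
  qed
  also have "\<dots> = M\<^sup>2 * (real N * (\<Sum>j<N. (cmod (coeff g j) * r ^ j)\<^sup>2))"
    using parseval_on_circle[OF N(2), of r] by (simp add: z_def flip: sum_distrib_left)
  also have "(\<Sum>j<N. (cmod (coeff g j) * r ^ j)\<^sup>2) = (\<Sum>j<m. (cmod (coeff g j) * r ^ j)\<^sup>2)"
    using assms(1) by (intro sum.mono_neutral_right) (auto simp: N_def coeff_eq_0)
  finally have "real N * (\<Sum>i<n. (cmod (coeff (g * f) i) * r ^ i)\<^sup>2)
      \<le> real N * (M\<^sup>2 * (\<Sum>j<m. (cmod (coeff g j) * r ^ j)\<^sup>2))"
    by (simp only: mult.left_commute)
  moreover have "0 < real N" by (simp add: N_def)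
  ultimately show ?thesis by (simp only: mult_le_cancel_left_pos)
qed

section \<open>The upper bound for the functional calculus\<close>

text \<open>With \<open>m = n - 1\<close>, the inverse of \<open>1 - 1 / n\<close> is \<open>1 + 1 / m \<le> exp (1 / m)\<close>.\<close>

lemma one_le_exp_mult_radius_power:
  assumes "2 \<le> n" "i < n"
  shows "1 \<le> exp 1 * (1 - 1 / real n) ^ i"
proof -
  define m where "m = n - 1"
  have m: "m > 0" "real n = real m + 1" using assms by (auto simp: m_def)
  have "1 = (1 + 1 / real m) ^ m * (1 - 1 / real n) ^ m"
  proof -
    have "(1 + 1 / real m) * (1 - 1 / real n) = 1"
      unfolding m(2) using m(1) by (simp add: divide_simps add_eq_0_iff)
    then show ?thesis by (simp flip: power_mult_distrib)
  qed
  also have "\<dots> \<le> exp (1 / real m) ^ m * (1 - 1 / real n) ^ m"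
    using m by (intro mult_right_mono power_mono exp_ge_add_one_self zero_le_power) auto
  also have "exp (1 / real m) ^ m = exp 1"
    using m by (simp flip: exp_of_nat_mult)
  also have "exp 1 * (1 - 1 / real n) ^ m \<le> exp 1 * (1 - 1 / real n) ^ i"
    using assms m by (intro mult_left_mono power_decreasing) (auto simp: m_def)
  finally show ?thesis .
qed

text \<open>Passing from weights \<open>r ^ j\<close> with \<open>r = 1 - 1 / n\<close> to weight one costs only \<open>r ^ (1 - n)\<close>,
  which is at most \<open>e\<close>. So the values of \<open>f\<close> on this smaller circle already control \<open>f(S)\<close>.\<close>

lemma op_norm_poly_at_trunc_shift_le:
  assumes "p > 0" "2 \<le> n"
    and M: "\<And>z. cmod z = 1 - 1 / real n \<Longrightarrow> cmod (poly f z) \<le> M"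
  shows "op_norm p n (poly_at_mat n f (trunc_shift n)) \<le> exp 1 * real n powr alpha_exp p * M"
proof (rule op_norm_leI)
  fix x assume x: "x \<in> carrier_vec n" "lp_norm p x \<le> 1"
  define r where "r = 1 - 1 / real n"
  define y where "y = poly_at_mat n f (trunc_shift n) *\<^sub>v x"
  have r: "0 < r" "r \<le> 1" using assms by (auto simp: r_def)
  have y: "dim_vec y = n" "\<And>i. i < n \<Longrightarrow> y $ i = coeff (vec_poly x * f) i"
    using x poly_at_mat_carrier[of n f "trunc_shift n"]
    by (auto simp: y_def poly_at_trunc_shift_eq_coeff_mult simp del: index_mult_mat_vec)
  have M0: "0 \<le> M"
    using M[of "of_real r"] r norm_ge_zero[of "poly f (of_real r)"]
    by (simp add: r_def[symmetric] del: norm_ge_zero)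
  have deg: "degree (vec_poly x) < n"
    using x assms by (intro degree_lessI) (auto simp: coeff_vec_poly)
  have "(\<Sum>i<n. (cmod (y $ i))\<^sup>2) \<le> (\<Sum>i<n. (exp 1)\<^sup>2 * (cmod (coeff (vec_poly x * f) i) * r ^ i)\<^sup>2)"
  proof (intro sum_mono)
    fix i assume "i \<in> {..<n}"
    then have "cmod (y $ i) * 1 \<le> cmod (coeff (vec_poly x * f) i) * (exp 1 * r ^ i)"
      using y one_le_exp_mult_radius_power[OF assms(2), of i]
      by (intro mult_mono) (auto simp: r_def)
    then have "(cmod (y $ i))\<^sup>2 \<le> (cmod (coeff (vec_poly x * f) i) * (exp 1 * r ^ i))\<^sup>2"
      by (intro power_mono) auto
    then show "(cmod (y $ i))\<^sup>2 \<le> (exp 1)\<^sup>2 * (cmod (coeff (vec_poly x * f) i) * r ^ i)\<^sup>2"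
      by (simp add: power_mult_distrib mult_ac)
  qed
  also have "\<dots> \<le> (exp 1)\<^sup>2 * (M\<^sup>2 * (\<Sum>j<n. (cmod (coeff (vec_poly x) j) * r ^ j)\<^sup>2))"
    unfolding sum_distrib_left[symmetric] using r
    by (intro mult_left_mono weighted_l2_coeff_mult_le deg M) (auto simp: r_def)
  also have "\<dots> \<le> (exp 1)\<^sup>2 * (M\<^sup>2 * (\<Sum>j<n. (cmod (x $ j))\<^sup>2))"
    using x r
    by (intro mult_left_mono sum_mono power_mono)
      (auto simp: coeff_vec_poly intro!: mult_left_le power_le_one)
  also have "(\<Sum>j<n. (cmod (x $ j))\<^sup>2) = (lp_norm 2 x)\<^sup>2"
    using lp_norm_powr[of 2 x] x by (simp add: lp_norm_nonneg)
  finally have "lp_norm 2 y \<le> exp 1 * M * lp_norm 2 x"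
    using M0 y by (subst lp_norm_le_iff) (auto simp: lp_norm_nonneg power_mult_distrib)
  then have "lp_norm p y \<le> exp 1 * M * real n powr alpha_exp p * lp_norm p x"
    using assms x y M0 by (intro lp_norm_bound_from_l2_bound) auto
  also have "\<dots> \<le> exp 1 * M * real n powr alpha_exp p * 1"
    using x M0 by (intro mult_left_mono) auto
  finally show "lp_norm p (poly_at_mat n f (trunc_shift n) *\<^sub>v x)
      \<le> exp 1 * real n powr alpha_exp p * M"
    by (simp add: y_def mult_ac)
qed

section \<open>Numerical ranges\<close>

lemma scalar_prod_duality_map:
  assumes "y \<in> carrier_vec n" "x \<in> carrier_vec n"
  shows "y \<bullet>c duality_map p x
      = (\<Sum>i<n. y $ i * cnj (x $ i) * complex_of_real (cmod (x $ i) powr (p - 2)))"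
  using assms
  by (auto simp: scalar_prod_def duality_map_def lessThan_atLeast0 mult.assoc intro!: sum.cong)

lemma scalar_prod_duality_map_self:
  assumes "p > 0" "x \<in> carrier_vec n" "lp_norm p x = 1"
  shows "x \<bullet>c duality_map p x = 1"
proof -
  have "x \<bullet>c duality_map p x = (\<Sum>i<n. complex_of_real (cmod (x $ i) powr p))"
  proof (unfold scalar_prod_duality_map[OF assms(2,2)], intro sum.cong refl)
    fix i
    show "x $ i * cnj (x $ i) * complex_of_real (cmod (x $ i) powr (p - 2))
        = complex_of_real (cmod (x $ i) powr p)"
    proof (cases "x $ i = 0")
      case False
      then have "complex_of_real (cmod (x $ i) powr p)
          = complex_of_real ((cmod (x $ i))\<^sup>2 * cmod (x $ i) powr (p - 2))"
        by (simp add: powr_diff)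
      then show ?thesis by (simp flip: complex_norm_square)
    qed simp
  qed
  also have "\<dots> = complex_of_real (lp_norm p x powr p)"
    using assms(1,2) by (simp add: lp_norm_powr)
  finally show ?thesis using assms by simp
qed

text \<open>This is Hoelder's inequality \<open>\<bar>\<langle>y, J(x)\<rangle>\<bar> \<le> \<parallel>y\<parallel>\<^sub>p \<parallel>J(x)\<parallel>\<^sub>q\<close>, obtained by applying Young's
  inequality to the coordinates of the normalised vectors.\<close>

lemma norm_scalar_prod_duality_map_le:
  assumes "p > 1" "y \<in> carrier_vec n" "x \<in> carrier_vec n" "lp_norm p x = 1"
  shows "cmod (y \<bullet>c duality_map p x) \<le> lp_norm p y"
proof -
  define b where "b = lp_norm p y"
  define q where "q = p / (p - 1)"
  have q: "q > 1" "1 / p + 1 / q = 1" "(p - 1) * q = p"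
    using assms by (auto simp: q_def field_simps)
  have b0: "0 \<le> b" by (simp add: b_def lp_norm_nonneg)
  have sums: "(\<Sum>i<n. cmod (x $ i) powr p) = 1" "(\<Sum>i<n. cmod (y $ i) powr p) = b powr p"
    using assms lp_norm_powr[of p x] lp_norm_powr[of p y] by (auto simp: b_def)
  have "cmod (y \<bullet>c duality_map p x) \<le> (\<Sum>i<n. cmod (y $ i) * cmod (x $ i) powr (p - 1))"
    unfolding scalar_prod_duality_map[OF assms(2,3)]
  proof (intro sum_norm_le)
    fix i
    show "cmod (y $ i * cnj (x $ i) * complex_of_real (cmod (x $ i) powr (p - 2)))
        \<le> cmod (y $ i) * cmod (x $ i) powr (p - 1)"
      by (cases "x $ i = 0") (auto simp: norm_mult norm_divide powr_diff power2_eq_square)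
  qed
  also have "\<dots> \<le> b"
  proof (cases "b = 0")
    case True
    then have "y $ i = 0" if "i < n" for i
      using norm_entry_le_lp_norm[of p i y] that assms by (simp add: b_def)
    then show ?thesis using True by simp
  next
    case False
    then have b: "b > 0" using b0 by simp
    have "(\<Sum>i<n. cmod (y $ i) * cmod (x $ i) powr (p - 1)) / b
        = (\<Sum>i<n. (cmod (y $ i) / b) * cmod (x $ i) powr (p - 1))"
      by (simp add: sum_divide_distrib)
    also have "\<dots> \<le> (\<Sum>i<n. (cmod (y $ i) / b) powr p / p + (cmod (x $ i) powr (p - 1)) powr q / q)"
      using assms q b by (intro sum_mono Youngs_inequality) auto
    also have "\<dots> = (\<Sum>i<n. cmod (y $ i) powr p) / b powr p / p + (\<Sum>i<n. cmod (x $ i) powr p) / q"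
      using b q by (simp add: sum.distrib sum_divide_distrib powr_divide powr_powr)
    also have "\<dots> = 1"
      using b q by (simp add: sums)
    finally show ?thesis using b by (simp add: divide_le_eq)
  qed
  finally show ?thesis by (simp add: b_def)
qed

text \<open>A point \<open>\<langle>Tx, J(x)\<rangle>\<close> is the value at \<open>T\<close> of the functional \<open>A \<mapsto> \<langle>Ax, J(x)\<rangle>\<close>, which has
  norm one and takes the value one at the identity.\<close>

lemma num_range_subset_alg_num_range:
  assumes "p > 1"
  shows "num_range p n T \<subseteq> alg_num_range p n T"
proof
  fix w assume "w \<in> num_range p n T"
  then obtain x where x: "x \<in> carrier_vec n" "lp_norm p x = 1"
    and w: "w = (T *\<^sub>v x) \<bullet>c duality_map p x"
    by (auto simp: num_range_def)
  define \<phi> where "\<phi> A = (A *\<^sub>v x) \<bullet>c duality_map p x" for A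
  have Ax: "A *\<^sub>v x \<in> carrier_vec n" if "A \<in> carrier_mat n n" for A
    using that x by auto
  have bound: "cmod (\<phi> A) \<le> op_norm p n A" if A: "A \<in> carrier_mat n n" for A
  proof -
    have "cmod (\<phi> A) \<le> lp_norm p (A *\<^sub>v x)"
      unfolding \<phi>_def using assms x Ax[OF A] by (intro norm_scalar_prod_duality_map_le)
    also have "\<dots> \<le> op_norm p n A"
      using assms x A by (intro lp_norm_le_op_norm) auto
    finally show ?thesis .
  qed
  have one: "\<phi> (1\<^sub>m n) = 1"
    using assms x by (simp add: \<phi>_def scalar_prod_duality_map_self)
  have add: "\<phi> (A + B) = \<phi> A + \<phi> B" if "A \<in> carrier_mat n n" "B \<in> carrier_mat n n" for A B
  proof -
    have "((A + B) *\<^sub>v x) $ i = (A *\<^sub>v x) $ i + (B *\<^sub>v x) $ i" if "i < n" for i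
      using x that \<open>A \<in> _\<close> \<open>B \<in> _\<close>
      by (simp add: mult_mat_vec_entry[of _ n] sum.distrib distrib_right del: index_mult_mat_vec)
    then show ?thesis
      using that Ax
      by (simp add: \<phi>_def scalar_prod_duality_map[OF _ x(1)] sum.distrib distrib_right
          del: index_mult_mat_vec)
  qed
  have smult: "\<phi> (c \<cdot>\<^sub>m A) = c * \<phi> A" if "A \<in> carrier_mat n n" for c A
  proof -
    have "((c \<cdot>\<^sub>m A) *\<^sub>v x) $ i = c * (A *\<^sub>v x) $ i" if "i < n" for i
      using x that \<open>A \<in> _\<close>
      by (simp add: mult_mat_vec_entry[of _ n] sum_distrib_left mult.assoc del: index_mult_mat_vec)
    then show ?thesis
      using that Ax
      by (simp add: \<phi>_def scalar_prod_duality_map[OF _ x(1)] sum_distrib_left mult.assoc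
          del: index_mult_mat_vec)
  qed
  have "\<phi> \<in> op_dual p n"
    unfolding op_dual_def using bound add smult by (auto intro!: exI[of _ 1])
  moreover have "dual_norm p n \<phi> = 1"
    unfolding dual_norm_def
  proof (rule cSup_eq_maximum)
    have "op_norm p n (1\<^sub>m n) \<le> 1"
      by (intro op_norm_leI) simp
    then show "1 \<in> (\<lambda>A. cmod (\<phi> A)) ` {A \<in> carrier_mat n n. op_norm p n A \<le> 1}"
      using one by (intro image_eqI[of _ _ "1\<^sub>m n"]) auto
    show "t \<le> 1" if "t \<in> (\<lambda>A. cmod (\<phi> A)) ` {A \<in> carrier_mat n n. op_norm p n A \<le> 1}" for t
      using that bound by fastforce
  qed
  ultimately show "w \<in> alg_num_range p n T"
    unfolding alg_num_range_def using one w by (auto simp: \<phi>_def[symmetric])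
qed

lemma op_norm_trunc_shift_le_1:
  assumes "p > 0"
  shows "op_norm p n (trunc_shift n) \<le> 1"
proof (rule op_norm_leI)
  fix x assume x: "x \<in> carrier_vec n" "lp_norm p x \<le> 1"
  have "(\<Sum>i<n. cmod ((trunc_shift n *\<^sub>v x) $ i) powr p) \<le> (\<Sum>i<n. cmod (x $ i) powr p)"
  proof (cases n)
    case (Suc m)
    have "(\<Sum>i<n. cmod ((trunc_shift n *\<^sub>v x) $ i) powr p)
        = (\<Sum>i<n. if i = 0 then 0 else cmod (x $ (i - 1)) powr p)"
      using x by (intro sum.cong) (auto simp: trunc_shift_mult_vec simp del: index_mult_mat_vec)
    also have "\<dots> = (\<Sum>i<m. cmod (x $ i) powr p)"
      unfolding Suc by (subst sum.lessThan_Suc_shift) simp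
    also have "\<dots> \<le> (\<Sum>i<n. cmod (x $ i) powr p)"
      by (intro sum_mono2) (auto simp: Suc)
    finally show ?thesis .
  qed simp
  also have "\<dots> = lp_norm p x powr p"
    using x assms by (simp add: lp_norm_powr)
  also have "\<dots> \<le> 1 powr p"
    using x assms by (intro powr_mono2) (auto simp: lp_norm_nonneg)
  finally show "lp_norm p (trunc_shift n *\<^sub>v x) \<le> 1"
    using x assms by (subst lp_norm_le_iff) (auto simp: trunc_shift_def)
qed

text \<open>A functional of dual norm one is at most one in modulus on the contraction \<open>S\<close>. The bound \<open>K\<close> in
  the definition of the dual space makes the supremum defining the dual norm one of a bounded
  set, so that it dominates this value.\<close>

lemma alg_num_range_trunc_shift_subset:
  assumes "p > 0"
  shows "alg_num_range p n (trunc_shift n) \<subseteq> {z. cmod z \<le> 1}"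
proof
  fix w assume "w \<in> alg_num_range p n (trunc_shift n)"
  then obtain \<phi> K where w: "w = \<phi> (trunc_shift n)" and norm: "dual_norm p n \<phi> = 1"
    and K: "\<And>A. A \<in> carrier_mat n n \<Longrightarrow> cmod (\<phi> A) \<le> K * op_norm p n A"
    unfolding alg_num_range_def op_dual_def by blast
  have "cmod (\<phi> A) \<le> \<bar>K\<bar>" if "A \<in> carrier_mat n n" "op_norm p n A \<le> 1" for A
  proof -
    have "cmod (\<phi> A) \<le> \<bar>K\<bar> * op_norm p n A"
      using K[OF that(1)] op_norm_nonneg[OF assms that(1)]
      by (meson abs_ge_self mult_right_mono order_trans)
    also have "\<dots> \<le> \<bar>K\<bar>" using that by (simp add: mult_left_le)
    finally show ?thesis .
  qed
  then have "bdd_above ((\<lambda>A. cmod (\<phi> A)) ` {A \<in> carrier_mat n n. op_norm p n A \<le> 1})"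
    by (intro bdd_aboveI2) auto
  then have "cmod w \<le> dual_norm p n \<phi>"
    unfolding dual_norm_def w using trunc_shift_carrier op_norm_trunc_shift_le_1[OF assms]
    by (intro cSUP_upper) auto
  then show "w \<in> {z. cmod z \<le> 1}" using norm by simp
qed

text \<open>The unimodular weights \<open>cnj u ^ j\<close> on the constant unit vector rotate the value \<open>1 - 1 / n\<close>
  by \<open>u\<close>: the \<open>n - 1\<close> nonzero coordinates of the shifted vector contribute \<open>u / n\<close> each.\<close>

lemma circle_subset_num_range:
  assumes "p > 0" "2 \<le> n"
  shows "{z. cmod z = 1 - 1 / real n} \<subseteq> num_range p n (trunc_shift n)"
proof
  fix z :: complex assume "z \<in> {z. cmod z = 1 - 1 / real n}"
  then have z: "cmod z = 1 - 1 / real n" by simp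
  define u where "u = z / of_real (1 - 1 / real n)"
  have n: "real n > 1" using assms by simp
  have u: "cmod u = 1"
    using n z by (simp add: u_def norm_divide del: of_real_diff)
  have uu: "cnj u * u = 1"
    using u by (metis complex_norm_square mult.commute of_real_1 power_one)
  define a where "a = real n powr (- 1 / p)"
  have a: "a > 0" using n by (simp add: a_def)
  have ap: "a powr p = 1 / real n"
  proof -
    have "a powr p = real n powr (- 1 / p * p)"
      by (simp only: a_def powr_powr)
    then show ?thesis using assms by (simp add: powr_minus_divide)
  qed
  define x where "x = vec n (\<lambda>j. cnj u ^ j * complex_of_real a)"
  have x: "x \<in> carrier_vec n" by (simp add: x_def)
  have modx: "cmod (x $ j) = a" if "j < n" for j
    using that a u by (simp add: x_def norm_mult norm_power)
  have "(\<Sum>j<dim_vec x. cmod (x $ j) powr p) = 1"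
    using x modx n by (simp add: ap)
  then have norm: "lp_norm p x = 1" by (simp add: lp_norm_def)
  have "(trunc_shift n *\<^sub>v x) \<bullet>c duality_map p x
      = (\<Sum>i<n. if i = 0 then 0 else u / of_nat n)"
  proof (subst scalar_prod_duality_map[OF _ x])
    show "trunc_shift n *\<^sub>v x \<in> carrier_vec n"
      using x trunc_shift_carrier[of n] by auto
    show "(\<Sum>i<n. (trunc_shift n *\<^sub>v x) $ i * cnj (x $ i) * complex_of_real (cmod (x $ i) powr (p - 2)))
        = (\<Sum>i<n. if i = 0 then 0 else u / of_nat n)"
    proof (intro sum.cong refl)
      fix i assume i: "i \<in> {..<n}"
      show "(trunc_shift n *\<^sub>v x) $ i * cnj (x $ i) * complex_of_real (cmod (x $ i) powr (p - 2))
          = (if i = 0 then 0 else u / of_nat n)"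
      proof (cases i)
        case 0
        then show ?thesis using i x by (simp add: trunc_shift_mult_vec del: index_mult_mat_vec)
      next
        case (Suc k)
        have "(trunc_shift n *\<^sub>v x) $ i * cnj (x $ i) = (cnj u * u) ^ k * u * complex_of_real (a * a)"
          using i x unfolding Suc
          by (simp add: trunc_shift_mult_vec x_def power_mult_distrib mult_ac del: index_mult_mat_vec)
        moreover have "a * a * a powr (p - 2) = 1 / real n"
          using a by (simp add: powr_diff power2_eq_square flip: ap)
        ultimately show ?thesis
          using i Suc modx[of i] by (simp add: uu mult.assoc flip: of_real_mult)
      qed
    qed
  qed
  also have "\<dots> = of_nat (n - 1) * (u / of_nat n)"
    using assms by (cases n) (simp_all add: sum.lessThan_Suc_shift del: sum.lessThan_Suc)
  also have "\<dots> = z"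
    using assms by (simp add: u_def of_nat_diff field_simps)
  finally show "z \<in> num_range p n (trunc_shift n)"
    unfolding num_range_def using x norm by force
qed

section \<open>Rudin--Shapiro polynomials\<close>

primrec rudin_shapiro :: "nat \<Rightarrow> complex poly \<times> complex poly" where
  "rudin_shapiro 0 = (1, 1)"
| "rudin_shapiro (Suc k) =
    (fst (rudin_shapiro k) + monom 1 (2 ^ k) * snd (rudin_shapiro k),
     fst (rudin_shapiro k) - monom 1 (2 ^ k) * snd (rudin_shapiro k))"

lemma rudin_shapiro_coeff_eq_0:
  assumes "2 ^ k \<le> j"
  shows "coeff (fst (rudin_shapiro k)) j = 0 \<and> coeff (snd (rudin_shapiro k)) j = 0"
  using assms by (induction k arbitrary: j) (auto simp: coeff_monom_mult)

text \<open>The two summands in the recursion occupy disjoint ranges of degrees.\<close>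

lemma rudin_shapiro_norm_coeff:
  assumes "j < 2 ^ k"
  shows "cmod (coeff (fst (rudin_shapiro k)) j) = 1 \<and> cmod (coeff (snd (rudin_shapiro k)) j) = 1"
  using assms
proof (induction k arbitrary: j)
  case (Suc k)
  then show ?case
    using Suc.IH[of "j - 2 ^ k"] rudin_shapiro_coeff_eq_0[of k j]
    by (cases "j < 2 ^ k") (auto simp: coeff_monom_mult)
qed simp

text \<open>By the parallelogram law and \<open>\<bar>z ^ 2 ^ k\<bar> \<le> 1\<close>, each step at most doubles the sum of squares,
  everywhere on the disc.\<close>

lemma rudin_shapiro_norm_le:
  assumes "cmod z \<le> 1"
  shows "(cmod (poly (fst (rudin_shapiro k)) z))\<^sup>2 + (cmod (poly (snd (rudin_shapiro k)) z))\<^sup>2 \<le> 2 * 2 ^ k"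
proof (induction k)
  case (Suc k)
  define a where "a = poly (fst (rudin_shapiro k)) z"
  define b where "b = poly (snd (rudin_shapiro k)) z"
  have parallelogram: "(cmod (s + t))\<^sup>2 + (cmod (s - t))\<^sup>2 = 2 * ((cmod s)\<^sup>2 + (cmod t)\<^sup>2)" for s t
    by (simp add: cmod_power2) (simp add: power2_eq_square algebra_simps)
  have "cmod (z ^ 2 ^ k * b) \<le> 1 * cmod b"
    unfolding norm_mult using assms by (intro mult_right_mono) (auto simp: norm_power power_le_one)
  then have "(cmod (z ^ 2 ^ k * b))\<^sup>2 \<le> (cmod b)\<^sup>2"
    by (intro power_mono) auto
  then have "(cmod (a + z ^ 2 ^ k * b))\<^sup>2 + (cmod (a - z ^ 2 ^ k * b))\<^sup>2
      \<le> 2 * ((cmod a)\<^sup>2 + (cmod b)\<^sup>2)"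
    unfolding parallelogram by simp
  also have "\<dots> \<le> 2 * (2 * 2 ^ k)"
    using Suc by (simp add: a_def b_def)
  finally show ?case by (simp add: poly_monom a_def b_def)
qed simp

text \<open>The first column of \<open>f(S)\<close> has \<open>p\<close>-norm at least \<open>N powr (1 / p)\<close>. A functional with \<open>N\<close>
  unimodular coefficients, the row of index \<open>N - 1\<close>, has \<open>q\<close>-norm \<open>N powr (1 - 1 / p)\<close>. The larger
  of the two exponents is \<open>1 / 2 + \<alpha>\<^sub>p\<close>.\<close>

lemma op_norm_poly_at_trunc_shift_ge:
  assumes "p > 0" "0 < N" "N \<le> n"
    and f: "\<And>j. j < N \<Longrightarrow> cmod (coeff f j) = 1"
  shows "real N powr (1 / 2 + alpha_exp p) \<le> op_norm p n (poly_at_mat n f (trunc_shift n))"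
proof -
  define F where "F = poly_at_mat n f (trunc_shift n)"
  have F: "F \<in> carrier_mat n n" by (simp add: F_def poly_at_mat_carrier)
  have "real N powr (1 / p) \<le> op_norm p n F"
  proof -
    define x where "x = vec n (\<lambda>j. if j = 0 then 1 else 0 :: complex)"
    have x: "x \<in> carrier_vec n" by (simp add: x_def)
    have "(\<Sum>j<dim_vec x. cmod (x $ j) powr p) = (\<Sum>j<n. if j = 0 then 1 else 0)"
      by (intro sum.cong) (auto simp: x_def)
    then have norm: "lp_norm p x \<le> 1" by (simp add: lp_norm_def)
    have Fx: "(F *\<^sub>v x) $ i = coeff f i" if "i < n" for i
    proof -
      have "(F *\<^sub>v x) $ i = (\<Sum>j\<le>i. if j = 0 then coeff f (i - j) else 0)"
        unfolding F_def poly_at_trunc_shift_mult_vec[OF x that]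
        using that by (intro sum.cong) (auto simp: x_def)
      then show ?thesis by simp
    qed
    have "real N = (\<Sum>i<N. cmod ((F *\<^sub>v x) $ i) powr p)"
      using assms by (simp add: Fx f del: index_mult_mat_vec)
    also have "\<dots> \<le> (\<Sum>i<dim_vec (F *\<^sub>v x). cmod ((F *\<^sub>v x) $ i) powr p)"
      using F assms by (intro sum_mono2) auto
    finally have "real N powr (1 / p) \<le> lp_norm p (F *\<^sub>v x)"
      unfolding lp_norm_def using assms by (intro powr_mono2) auto
    then show ?thesis
      using lp_norm_le_op_norm[OF assms(1) F x norm] by simp
  qed
  moreover have "real N powr (1 - 1 / p) \<le> op_norm p n F"
  proof -
    define a where "a = real N powr (- 1 / p)"
    have a: "a > 0" using assms by (simp add: a_def)
    have ap: "a powr p = 1 / real N"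
    proof -
      have "a powr p = real N powr (- 1 / p * p)"
        by (simp only: a_def powr_powr)
      then show ?thesis using assms by (simp add: powr_minus_divide)
    qed
    \<comment> \<open>The unit vector aligned with the row of index \<open>N - 1\<close>: each of its \<open>N\<close> products is \<open>a\<close>.\<close>
    define x where "x = vec n (\<lambda>j. if j < N then cnj (coeff f (N - 1 - j)) * complex_of_real a else 0)"
    have x: "x \<in> carrier_vec n" by (simp add: x_def)
    have "(\<Sum>j<dim_vec x. cmod (x $ j) powr p) = (\<Sum>j<N. 1 / real N)"
      using assms a by (intro sum.mono_neutral_cong_right) (auto simp: x_def norm_mult f ap)
    then have norm: "lp_norm p x \<le> 1" using assms by (simp add: lp_norm_def)
    have "(F *\<^sub>v x) $ (N - 1) = (\<Sum>j\<le>N - 1. complex_of_real a)"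
      unfolding F_def
    proof (subst poly_at_trunc_shift_mult_vec[OF x])
      show "N - 1 < n" using assms by simp
      show "(\<Sum>j\<le>N - 1. coeff f (N - 1 - j) * x $ j) = (\<Sum>j\<le>N - 1. complex_of_real a)"
      proof (intro sum.cong refl)
        fix j assume j: "j \<in> {..N - 1}"
        have "coeff f (N - 1 - j) * cnj (coeff f (N - 1 - j)) = 1"
          using f[of "N - 1 - j"] assms by (simp flip: complex_norm_square)
        then show "coeff f (N - 1 - j) * x $ j = complex_of_real a"
          using j assms by (simp add: x_def flip: mult.assoc)
      qed
    qed
    also have "\<dots> = complex_of_real (real N * a)" using assms by simp
    finally have "cmod ((F *\<^sub>v x) $ (N - 1)) = real N * a"
      using a by (simp add: norm_mult del: index_mult_mat_vec)
    moreover have "cmod ((F *\<^sub>v x) $ (N - 1)) \<le> lp_norm p (F *\<^sub>v x)"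
      using assms F by (intro norm_entry_le_lp_norm) auto
    moreover have "real N * a = real N powr (1 - 1 / p)"
      using assms by (simp add: a_def powr_diff powr_minus_divide)
    ultimately show ?thesis
      using lp_norm_le_op_norm[OF assms(1) F x norm] by simp
  qed
  moreover have "alpha_exp p = (if 1 / 2 \<le> 1 / p then 1 / p - 1 / 2 else 1 / 2 - 1 / p)"
    by (simp add: alpha_exp_def)
  ultimately have "real N powr (1 / 2 + alpha_exp p) \<le> op_norm p n F"
    by (cases "1 / 2 \<le> 1 / p") simp_all
  then show ?thesis unfolding F_def .
qed

section \<open>The spectral constant of the truncated shift\<close>

text \<open>The quotient is taken in the extended reals. There it vanishes if the supremum is infinite, and
  also if \<open>f\<close> vanishes on \<open>E\<close>, because then the numerator is zero as well and \<open>0 / 0 = 0\<close>.\<close>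

lemma norm_ratio_le:
  assumes "p > 0" "2 \<le> n" "{z. cmod z = 1 - 1 / real n} \<subseteq> E"
  shows "ereal (op_norm p n (poly_at_mat n f (trunc_shift n))) / sup_norm_on E f
      \<le> ereal (exp 1 * real n powr alpha_exp p)"
proof -
  define A where "A = op_norm p n (poly_at_mat n f (trunc_shift n))"
  have A: "0 \<le> A"
    using assms by (simp add: A_def op_norm_nonneg poly_at_mat_carrier)
  have upper: "ereal (cmod (poly f z)) \<le> sup_norm_on E f" if "cmod z = 1 - 1 / real n" for z
    unfolding sup_norm_on_def using assms that by (intro SUP_upper) auto
  show ?thesis
  proof (cases "sup_norm_on E f")
    case (real M)
    then have le: "cmod (poly f z) \<le> M" if "cmod z = 1 - 1 / real n" for z
      using upper[OF that] by simp
    have "cmod (complex_of_real (1 - 1 / real n)) = 1 - 1 / real n"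
      using assms by (simp only: norm_of_real) simp
    then have M: "0 \<le> M" using le norm_ge_zero order_trans by blast
    have "A \<le> exp 1 * real n powr alpha_exp p * M"
      unfolding A_def using assms le by (intro op_norm_poly_at_trunc_shift_le)
    then show ?thesis
      using M A by (cases "M = 0") (auto simp: real A_def[symmetric] divide_le_eq)
  next
    case PInf
    then show ?thesis by simp
  next
    case MInf
    have "cmod (complex_of_real (1 - 1 / real n)) = 1 - 1 / real n"
      using assms by (simp only: norm_of_real) simp
    from upper[OF this] show ?thesis by (simp add: MInf)
  qed
qed

text \<open>For the Rudin--Shapiro polynomial with \<open>N\<close> coefficients, \<open>n / 2 < N \<le> n\<close>, the quotient is at least
  \<open>N powr (1 / 2 + \<alpha>\<^sub>p) / sqrt (2 * N)\<close>. One factor \<open>sqrt 2\<close> is lost here and at most another one in replacing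
  \<open>N\<close> by \<open>n\<close>, which gives the constant \<open>1 / 2\<close>.\<close>

lemma exists_norm_ratio_ge:
  assumes "1 < p" "2 \<le> n" "E \<noteq> {}" "E \<subseteq> {z. cmod z \<le> 1}"
  shows "\<exists>f. f \<noteq> 0 \<and> ereal (1 / 2 * real n powr alpha_exp p)
      \<le> ereal (op_norm p n (poly_at_mat n f (trunc_shift n))) / sup_norm_on E f"
proof -
  have "\<exists>k. 2 ^ k \<le> n \<and> n < 2 ^ (k + 1)"
    using assms(2) by (intro ex_power_ivl1) simp_all
  then obtain k where k: "2 ^ k \<le> n" "n < 2 ^ Suc k"
    unfolding Suc_eq_plus1 by blast
  define N :: nat where "N = 2 ^ k"
  have N: "0 < N" "N \<le> n" "n \<le> 2 * N"
    using k by (auto simp: N_def)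
  have n_le: "real n \<le> 2 * real N"
    using N(3) by linarith
  define f where "f = fst (rudin_shapiro k)"
  define A where "A = op_norm p n (poly_at_mat n f (trunc_shift n))"
  define \<alpha> where "\<alpha> = alpha_exp p"
  have \<alpha>: "0 \<le> \<alpha>" "\<alpha> \<le> 1 / 2"
    using assms by (auto simp: \<alpha>_def alpha_exp_def abs_le_iff field_simps)
  have f: "cmod (coeff f j) = 1" if "j < N" for j
    using rudin_shapiro_norm_coeff[of j k] that by (simp add: f_def N_def)
  have f0: "f \<noteq> 0" using f[of 0] N by auto
  have poly_le: "cmod (poly f z) \<le> sqrt (2 * real N)" if "z \<in> E" for z
  proof (rule real_le_rsqrt)
    have "cmod z \<le> 1" using that assms by blast
    from rudin_shapiro_norm_le[OF this, of k]
    have "(cmod (poly f z))\<^sup>2 \<le> 2 * 2 ^ k"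
      unfolding f_def by (rule order_trans[rotated]) simp
    then show "(cmod (poly f z))\<^sup>2 \<le> 2 * real N"
      by (simp add: N_def)
  qed
  have sup_le: "sup_norm_on E f \<le> ereal (sqrt (2 * real N))"
    unfolding sup_norm_on_def using poly_le by (intro SUP_least) simp
  have sup_ge: "0 \<le> sup_norm_on E f"
  proof -
    obtain z where "z \<in> E" using assms by auto
    then have "ereal (cmod (poly f z)) \<le> sup_norm_on E f"
      unfolding sup_norm_on_def by (rule SUP_upper)
    then show ?thesis using norm_ge_zero[of "poly f z"] by (meson ereal_less_eq(5) order_trans)
  qed
  have "1 / 2 * real n powr \<alpha> \<le> 1 / 2 * (2 * real N) powr \<alpha>"
    using n_le \<alpha> by (intro mult_left_mono powr_mono2) auto
  also have "\<dots> \<le> 1 / 2 * (2 powr (1 / 2) * real N powr \<alpha>)"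
    using \<alpha> by (auto simp: powr_mult intro!: mult_left_mono mult_right_mono powr_mono)
  finally have "1 / 2 * real n powr \<alpha> * sqrt (2 * real N)
      \<le> 1 / 2 * (sqrt 2 * real N powr \<alpha>) * sqrt (2 * real N)"
    by (intro mult_right_mono) (auto simp: powr_half_sqrt)
  also have "\<dots> = real N powr (1 / 2 + \<alpha>)"
    using N by (simp add: real_sqrt_mult powr_add powr_half_sqrt)
  also have "\<dots> \<le> A"
    unfolding A_def \<alpha>_def using assms N f by (intro op_norm_poly_at_trunc_shift_ge) auto
  finally have A: "1 / 2 * real n powr \<alpha> * sqrt (2 * real N) \<le> A" .
  have "0 < 1 / 2 * real n powr \<alpha> * sqrt (2 * real N)"
    using N assms by simp
  then have A0: "0 < A" using A by linarith
  have "ereal (1 / 2 * real n powr \<alpha>) \<le> ereal A / sup_norm_on E f"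
  proof (cases "sup_norm_on E f")
    case (real M)
    then have M: "0 \<le> M" "M \<le> sqrt (2 * real N)" using sup_le sup_ge by auto
    show ?thesis
    proof (cases "M = 0")
      case True
      then show ?thesis using A0 by (simp add: real divide_ereal_def zero_ereal_def[symmetric])
    next
      case False
      have "1 / 2 * real n powr \<alpha> * M \<le> 1 / 2 * real n powr \<alpha> * sqrt (2 * real N)"
        using M by (intro mult_left_mono) auto
      then have "1 / 2 * real n powr \<alpha> * M \<le> A" using A by linarith
      then show ?thesis using M False by (simp add: real le_divide_eq)
    qed
  qed (use sup_le sup_ge in auto)
  then show ?thesis using f0 unfolding A_def \<alpha>_def by blast
qed

lemma spectral_constant_bounds:
  fixes p :: real and n :: nat and E :: "complex set"
  assumes p: "1 < p" and n: "2 \<le> n"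
    and E: "{z. cmod z = 1 - 1 / real n} \<subseteq> E" "E \<subseteq> {z. cmod z \<le> 1}"
  defines "R \<equiv> (SUP f\<in>{f :: complex poly. f \<noteq> 0}.
    ereal (op_norm p n (poly_at_mat n f (trunc_shift n))) / sup_norm_on E f)"
  shows "ereal (1 / 2 * real n powr alpha_exp p) \<le> R"
    and "R \<le> ereal (exp 1 * real n powr alpha_exp p)"
proof -
  have "complex_of_real (1 - 1 / real n) \<in> {z. cmod z = 1 - 1 / real n}"
    using n by (simp only: mem_Collect_eq norm_of_real) simp
  then have "E \<noteq> {}" using E(1) by blast
  then obtain f where f: "f \<noteq> 0" and le: "ereal (1 / 2 * real n powr alpha_exp p)
      \<le> ereal (op_norm p n (poly_at_mat n f (trunc_shift n))) / sup_norm_on E f"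
    using exists_norm_ratio_ge[OF p n _ E(2)] by blast
  show "ereal (1 / 2 * real n powr alpha_exp p) \<le> R"
    unfolding R_def using f by (intro order_trans[OF le] SUP_upper) simp
  show "R \<le> ereal (exp 1 * real n powr alpha_exp p)"
    unfolding R_def using p n E(1) by (intro SUP_least norm_ratio_le) auto
qed

theorem proposition4p16:
  shows "\<exists>c::real. c > 0 \<and> (\<forall>(p::real) (n::nat). 1 < p \<longrightarrow> 2 \<le> n \<longrightarrow>
    (let S = trunc_shift n;
         ratio_sup = (\<lambda>E. SUP f\<in>{f :: complex poly. f \<noteq> 0}.
           ereal (op_norm p n (poly_at_mat n f S)) / sup_norm_on E f)
     in ereal (c * real n powr alpha_exp p) \<le> ratio_sup (num_range p n S) \<and>
        ratio_sup (num_range p n S) \<le> ereal (exp 1 * real n powr alpha_exp p) \<and>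
        ereal (c * real n powr alpha_exp p) \<le> ratio_sup (alg_num_range p n S) \<and>
        ratio_sup (alg_num_range p n S) \<le> ereal (exp 1 * real n powr alpha_exp p)))"
proof (intro exI[of _ "1 / 2"] conjI allI impI)
  fix p :: real and n :: nat
  assume p: "1 < p" and n: "2 \<le> n"
  let ?C = "{z. cmod z = 1 - 1 / real n}"
  let ?W = "num_range p n (trunc_shift n)"
  let ?V = "alg_num_range p n (trunc_shift n)"
  have CW: "?C \<subseteq> ?W" and WV: "?W \<subseteq> ?V" and V: "?V \<subseteq> {z. cmod z \<le> 1}"
    using p n circle_subset_num_range num_range_subset_alg_num_range
      alg_num_range_trunc_shift_subset by auto
  note W_bounds = spectral_constant_bounds[OF p n CW order_trans[OF WV V]]
  note V_bounds = spectral_constant_bounds[OF p n order_trans[OF CW WV] V]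
  show "let S = trunc_shift n;
         ratio_sup = (\<lambda>E. SUP f\<in>{f :: complex poly. f \<noteq> 0}.
           ereal (op_norm p n (poly_at_mat n f S)) / sup_norm_on E f)
     in ereal (1 / 2 * real n powr alpha_exp p) \<le> ratio_sup (num_range p n S) \<and>
        ratio_sup (num_range p n S) \<le> ereal (exp 1 * real n powr alpha_exp p) \<and>
        ereal (1 / 2 * real n powr alpha_exp p) \<le> ratio_sup (alg_num_range p n S) \<and>
        ratio_sup (alg_num_range p n S) \<le> ereal (exp 1 * real n powr alpha_exp p)"
    unfolding Let_def by (intro conjI W_bounds V_bounds)
qed simp

end
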